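(* Let $A$ be a real matrix with $N$ columns, $b$ a real vector of compatible dimension, $\lambda>0$, and $$\Phi^0(x)=\tfrac12\|b-Ax\|_2^2+\lambda\|x\|_0,\qquad x\in\mathbb{R}^N .$$ Let $\alpha>0$, $h>\|A\|_2^2$, $0<\eta<1$, $M\in\mathbb{N}$, and let $\{x^k\}_{k=0,1,2,\ldots}$ be generated by the iterative hard thresholding algorithm with line search (as defined in the context) with these parameters from an initial point $x^0\in\mathbb{R}^N$. If $\{x^k\}$ is bounded, then the whole sequence $\{x^k\}$ converges to a critical point of $\Phi^0$, i.e. to a point $x^*$ with $\mathbf{0}\in\partial\Phi^0(x^* )$.
   Context: $\|x\|_0$ is the number of nonzero entries of $x$; $\|A\|_2$ is the spectral norm. The hard thresholding operator $\mathrm{H}_{\lambda/h}$ acts componentwise by $\mathrm{H}_{\lambda/h}(t)=t$ if $|t|\ge\sqrt{2\lambda/h}$ and $\mathrm{H}_{\lambda/h}(t)=0$ otherwise. Iterative hard thresholding (IHT) with line search: for $k=0,1,2,\ldots$: (1) $y^k=\mathrm{H}_{\lambda/h}\big(x^k-\tfrac1h A^\top(Ax^k-b)\big)$ and $d^k=y^k-x^k$; (2) let $m_k$ be the smallest positive integer $m$ such that $\Phi^0(y^k+\eta^m d^k)\le\Phi^0(y^k)-\alpha\eta^m\|d^k\|_2^2$ (with $m_k=+\infty$ if there is none); (3) set $\eta_k=\eta^{m_k}$ if $m_k\le M$ and $\eta_k=0$ if $m_k>M$; (4) $x^{k+1}=x^k+(\eta_k+1)d^k$. Subdifferentials: for a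 proper lower semicontinuous $J:\mathbb{R}^N\to(-\infty,+\infty]$ and $x$ with $J(x)<+\infty$, the Fréchet subdifferential $\hat\partial J(x)$ is the set of $u\in\mathbb{R}^N$ with $\liminf_{y\to x,\,y\ne x}\frac{J(y)-J(x)-\langle u,y-x\rangle}{\|y-x\|_2}\ge 0$ (and $\hat\partial J(x)=\emptyset$ if $J(x)=+\infty$). The (limiting) subdifferential is $\partial J(x)=\{u:\exists\, x^k\to x,\ J(x^k)\to J(x),\ u^k\in\hat\partial J(x^k),\ u^k\to u\}$. *)

theory Defs
  imports "HOL-Analysis.Analysis" "HOL-Library.Extended_Nat"
begin

definition l0_norm :: "real ^ 'n \<Rightarrow> nat" where
  "l0_norm x = card {i. x $ i \<noteq> 0}"

(* The norms of real ^ 'n and real ^ 'm are Euclidean, so the operator norm is the spectral norm.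
   The library's norm on real ^ 'n ^ 'm itself is the Frobenius norm. *)
definition spectral_norm :: "real ^ 'n ^ 'm \<Rightarrow> real" where
  "spectral_norm A = onorm (\<lambda>x. A *v x)"

definition Phi0 :: "real ^ 'n ^ 'm \<Rightarrow> real ^ 'm \<Rightarrow> real \<Rightarrow> real ^ 'n \<Rightarrow> real" where
  "Phi0 A b lam x = 1 / 2 * (norm (b - A *v x))\<^sup>2 + lam * real (l0_norm x)"

subsection \<open>Subdifferentials\<close>

(* J is meant to be proper and lower semicontinuous with values in (-\<infinity>, \<infinity>]. Since J x is then
   finite outside the first case, the difference quotient never has the form \<infinity> - \<infinity>. *)
definition frechet_subdifferential :: "('a::euclidean_space \<Rightarrow> ereal) \<Rightarrow> 'a \<Rightarrow> 'a set" where
  "frechet_subdifferential J x =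
     (if J x = \<infinity> then {}
      else {u. 0 \<le> Liminf (at x) (\<lambda>y. (J y - J x - ereal (u \<bullet> (y - x))) / ereal (norm (y - x)))})"

definition limiting_subdifferential :: "('a::euclidean_space \<Rightarrow> ereal) \<Rightarrow> 'a \<Rightarrow> 'a set" where
  "limiting_subdifferential J x =
     {u. J x < \<infinity> \<and>
         (\<exists>xs us. xs \<longlonglongrightarrow> x \<and> (\<lambda>k. J (xs k)) \<longlonglongrightarrow> J x \<and>
                  (\<forall>k. us k \<in> frechet_subdifferential J (xs k)) \<and> us \<longlonglongrightarrow> u)}"

subsection \<open>Iterative hard thresholding with line search\<close>

definition hard_threshold :: "real \<Rightarrow> real ^ 'n \<Rightarrow> real ^ 'n" where
  "hard_threshold g z = (\<chi> i. if \<bar>z $ i\<bar> \<ge> sqrt (2 * g) then z $ i else 0)"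

definition iht_y :: "real ^ 'n ^ 'm \<Rightarrow> real ^ 'm \<Rightarrow> real \<Rightarrow> real \<Rightarrow> real ^ 'n \<Rightarrow> real ^ 'n" where
  "iht_y A b lam h x =
     hard_threshold (lam / h) (x - (1 / h) *\<^sub>R (transpose A *v (A *v x - b)))"

(* The infimum of the empty set in enat is \<infinity>, which is the value if no exponent is acceptable. *)
definition line_search_index ::
  "(real ^ 'n \<Rightarrow> real) \<Rightarrow> real \<Rightarrow> real \<Rightarrow> real ^ 'n \<Rightarrow> real ^ 'n \<Rightarrow> enat" where
  "line_search_index F alpha eta y d =
     (INF m \<in> {m::nat. 1 \<le> m \<and>
                F (y + eta ^ m *\<^sub>R d) \<le> F y - alpha * eta ^ m * (norm d)\<^sup>2}. enat m)"

definition line_search_step ::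
  "(real ^ 'n \<Rightarrow> real) \<Rightarrow> real \<Rightarrow> real \<Rightarrow> nat \<Rightarrow> real ^ 'n \<Rightarrow> real ^ 'n \<Rightarrow> real" where
  "line_search_step F alpha eta M y d =
     (let m = line_search_index F alpha eta y d
      in if m \<le> enat M then eta ^ the_enat m else 0)"

definition iht_ls_update ::
  "real ^ 'n ^ 'm \<Rightarrow> real ^ 'm \<Rightarrow> real \<Rightarrow> real \<Rightarrow> real \<Rightarrow> real \<Rightarrow> nat \<Rightarrow> real ^ 'n \<Rightarrow> real ^ 'n" where
  "iht_ls_update A b lam h alpha eta M x =
     (let y = iht_y A b lam h x;
          d = y - x
      in x + (line_search_step (Phi0 A b lam) alpha eta M y d + 1) *\<^sub>R d)"

definition iht_ls_sequence ::
  "real ^ 'n ^ 'm \<Rightarrow> real ^ 'm \<Rightarrow> real \<Rightarrow> real \<Rightarrow> real \<Rightarrow> real \<Rightarrow> nat \<Rightarrow> (nat \<Rightarrow> real ^ 'n) \<Rightarrow> bool" where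
  "iht_ls_sequence A b lam h alpha eta M x \<longleftrightarrow>
     (\<forall>k. x (Suc k) = iht_ls_update A b lam h alpha eta M (x k))"

end

theory Submission
  imports Defs
begin

text \<open>
  In each step the objective decreases by at least a positive multiple of
  \<open>\<parallel>d\<^sup>k\<parallel>\<^sup>2\<close>, so \<open>d\<^sup>k\<close> tends to 0. Nonzero entries of \<open>y\<^sup>k\<close> are at least \<open>sqrt (2 * (\<lambda> / h))\<close> in
  absolute value, so the support \<open>S\<close> of \<open>y\<^sup>k\<close> is eventually constant. From then on the entries
  of \<open>x\<^sup>k\<close> outside \<open>S\<close> shrink at least by the factor \<open>\<eta>\<close> in each step, and the entries in \<open>S\<close> follow
  gradient descent on a least squares problem with step sizes below \<open>2 / \<parallel>A\<parallel>\<^sup>2\<close>, which is a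
  nonexpansive iteration. Hence \<open>x\<^sup>k\<close> is quasi-Fejer monotone with respect to each of its cluster
  points and so converges. On a small ball around the limit, a support different from \<open>S\<close> costs
  more than the linear part of the smooth term can gain, so the limit is a local minimizer.
\<close>

section \<open>Subdifferentials at local minimizers\<close>

lemma zero_in_frechet_subdifferential:
  fixes f :: "'a::euclidean_space \<Rightarrow> real"
  assumes "\<forall>\<^sub>F y in at x. f x \<le> f y"
  shows "0 \<in> frechet_subdifferential (\<lambda>z. ereal (f z)) x"
proof -
  have "\<forall>\<^sub>F y in at x. (0::ereal) \<le>
          (ereal (f y) - ereal (f x) - ereal (0 \<bullet> (y - x))) / ereal (norm (y - x))"
    using assms by eventually_elim auto
  then have "0 \<le> Liminf (at x) (\<lambda>y.
      (ereal (f y) - ereal (f x) - ereal (0 \<bullet> (y - x))) / ereal (norm (y - x)))"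
    by (rule Liminf_bounded)
  then show ?thesis
    unfolding frechet_subdifferential_def by (simp del: ereal_divide)
qed

text \<open>Constant sequences meet every requirement of the limiting definition.\<close>

lemma frechet_subset_limiting_subdifferential:
  "frechet_subdifferential J x \<subseteq> limiting_subdifferential J x"
proof
  fix u assume u: "u \<in> frechet_subdifferential J x"
  then have "J x < \<infinity>"
    unfolding frechet_subdifferential_def by (auto split: if_splits)
  with u show "u \<in> limiting_subdifferential J x"
    unfolding limiting_subdifferential_def mem_Collect_eq
    by (intro conjI exI[of _ "\<lambda>_. x"] exI[of _ "\<lambda>_. u"]) auto
qed

section \<open>The spectral norm and gradient steps\<close>

lemma spectral_norm_nonneg: "0 \<le> spectral_norm A"
  unfolding spectral_norm_def
  by (intro onorm_pos_le) (simp add: linear_conv_bounded_linear[symmetric])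

lemma norm_matrix_vector_le: "norm (A *v x) \<le> spectral_norm A * norm x"
  unfolding spectral_norm_def
  by (intro onorm) (simp add: linear_conv_bounded_linear[symmetric])

text \<open>The adjoint identity and Cauchy-Schwarz bound the squared norm of
  \<open>transpose A *v w\<close>; one factor of that norm then cancels, which is why the zero case
  is split off.\<close>

lemma norm_transpose_matrix_vector_le:
  "norm (transpose A *v w) \<le> spectral_norm A * norm w"
proof (cases "transpose A *v w = 0")
  case True
  then show ?thesis by (simp add: spectral_norm_nonneg)
next
  case False
  let ?u = "transpose A *v w"
  have "norm ?u * norm ?u = (A *v ?u) \<bullet> w"
    by (simp add: dot_lmul_matrix[symmetric] transpose_matrix_vector
        norm_eq_sqrt_inner inner_commute)
  also have "\<dots> \<le> norm (A *v ?u) * norm w"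
    by (rule norm_cauchy_schwarz)
  also have "\<dots> \<le> spectral_norm A * norm ?u * norm w"
    by (intro mult_right_mono norm_matrix_vector_le) simp
  finally show ?thesis
    using False by simp
qed

text \<open>The symmetric map applied to \<open>v\<close> has its eigenvalues
  \<open>1 - t * sigma^2\<close> in [-1, 1], with \<open>sigma\<close> a singular value of
  \<open>A\<close>. The proof instead expands the square: the cross term outweighs the term
  quadratic in \<open>t\<close>.\<close>

lemma gradient_step_nonexpansive:
  assumes "0 \<le> t" and "t * (spectral_norm A)\<^sup>2 \<le> 2"
  shows "norm (v - t *\<^sub>R (transpose A *v (A *v v))) \<le> norm v"
proof -
  let ?g = "transpose A *v (A *v v)"
  have vg: "v \<bullet> ?g = (norm (A *v v))\<^sup>2"
    by (simp add: dot_lmul_matrix[symmetric] transpose_matrix_vector power2_norm_eq_inner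
        inner_commute)
  have "(norm ?g)\<^sup>2 \<le> (spectral_norm A * norm (A *v v))\<^sup>2"
    by (intro power_mono norm_transpose_matrix_vector_le) simp
  then have "t * (norm ?g)\<^sup>2 \<le> t * (spectral_norm A)\<^sup>2 * (norm (A *v v))\<^sup>2"
    using assms(1) by (simp add: power_mult_distrib mult_left_mono mult.assoc)
  also have "\<dots> \<le> 2 * (norm (A *v v))\<^sup>2"
    using assms(2) by (intro mult_right_mono) auto
  finally have le: "t * (t * (norm ?g)\<^sup>2) \<le> t * (2 * (norm (A *v v))\<^sup>2)"
    using assms(1) by (rule mult_left_mono)
  have "(norm (v - t *\<^sub>R ?g))\<^sup>2 = (norm v)\<^sup>2 - 2 * t * (v \<bullet> ?g) + t\<^sup>2 * (norm ?g)\<^sup>2"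
    by (simp only: power2_norm_eq_inner)
      (simp add: inner_diff_left inner_diff_right inner_commute power2_eq_square algebra_simps)
  also have "\<dots> \<le> (norm v)\<^sup>2"
    using le unfolding vg power2_eq_square[of t] by (simp add: algebra_simps)
  finally show ?thesis
    by (rule power2_le_imp_le) simp
qed

text \<open>The exact Taylor formula of the smooth term at \<open>x\<close>. It serves the descent
  estimate and, expanded at the limit, local minimality.\<close>

lemma quadratic_expansion:
  fixes A :: "real ^ 'n ^ 'm"
  shows "1 / 2 * (norm (b - A *v z))\<^sup>2 =
     1 / 2 * (norm (b - A *v x))\<^sup>2 + (transpose A *v (A *v x - b)) \<bullet> (z - x)
       + 1 / 2 * (norm (A *v (z - x)))\<^sup>2"
proof -
  have "(transpose A *v (A *v x - b)) \<bullet> (z - x) = (A *v x - b) \<bullet> (A *v (z - x))"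
    by (simp add: dot_lmul_matrix transpose_matrix_vector)
  moreover have "b - A *v z = - ((A *v x - b) + A *v (z - x))"
    by (simp add: matrix_vector_mult_diff_distrib)
  moreover have "norm (b - A *v x) = norm (A *v x - b)"
    by (rule norm_minus_commute)
  ultimately show ?thesis
    by (simp only: norm_minus_cancel power2_norm_eq_inner)
      (simp add: inner_add_left inner_add_right inner_commute algebra_simps)
qed

lemma l0_norm_eq_sum: "real (l0_norm x) = (\<Sum>i\<in>UNIV. of_bool (x $ i \<noteq> 0))"
  unfolding l0_norm_def by (simp add: of_bool_def sum.If_cases)

section \<open>Descent of the objective\<close>

text \<open>Thresholding is a proximal map of the l0 penalty: keeping \<open>p\<close> costs
  \<open>lam\<close>, replacing it by 0 costs \<open>h / 2 * p^2\<close>, and the two costs agree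
  exactly at the threshold.\<close>

lemma hard_threshold_minimizes:
  fixes h lam p z :: real
  assumes "0 < h" and "0 < lam"
    and y: "y = (if \<bar>p\<bar> \<ge> sqrt (2 * (lam / h)) then p else 0)"
  shows "h / 2 * (y - p)\<^sup>2 + lam * of_bool (y \<noteq> 0) \<le> h / 2 * (z - p)\<^sup>2 + lam * of_bool (z \<noteq> 0)"
proof -
  have s: "sqrt (2 * (lam / h)) \<le> \<bar>p\<bar> \<longleftrightarrow> lam \<le> h / 2 * p\<^sup>2"
    using assms(1,2) real_sqrt_le_iff[of "2 * (lam / h)" "p\<^sup>2"] by (simp add: field_simps)
  have "0 \<le> h / 2 * (z - p)\<^sup>2"
    using assms(1) by simp
  then show ?thesis
    using assms(2) s y by (cases "z = 0") auto
qed

lemma iht_y_component: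
  "iht_y A b lam h x $ i =
     (let p = x $ i - (1 / h) * (transpose A *v (A *v x - b)) $ i
      in if \<bar>p\<bar> \<ge> sqrt (2 * (lam / h)) then p else 0)"
  unfolding iht_y_def hard_threshold_def Let_def by simp

text \<open>The point \<open>y\<close> minimizes a separable majorant of the objective with
  curvature \<open>h\<close>; the excess of \<open>h\<close> over the squared spectral norm is what
  remains as decrease.\<close>

lemma iht_y_descent:
  fixes A :: "real ^ 'n ^ 'm" and b :: "real ^ 'm" and x :: "real ^ 'n"
  assumes "0 < h" and "0 < lam"
  defines "y \<equiv> iht_y A b lam h x"
  shows "Phi0 A b lam y + (h - (spectral_norm A)\<^sup>2) / 2 * (norm (y - x))\<^sup>2 \<le> Phi0 A b lam x"
proof -
  let ?g = "transpose A *v (A *v x - b)"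
  have comp: "?g $ i * (y - x) $ i + h / 2 * ((y - x) $ i)\<^sup>2 + lam * of_bool (y $ i \<noteq> 0)
      \<le> lam * of_bool (x $ i \<noteq> 0)" for i
  proof -
    let ?p = "x $ i - (1 / h) * ?g $ i"
    have "h / 2 * (y $ i - ?p)\<^sup>2 + lam * of_bool (y $ i \<noteq> 0)
        \<le> h / 2 * (x $ i - ?p)\<^sup>2 + lam * of_bool (x $ i \<noteq> 0)"
      using assms(1,2) unfolding y_def iht_y_component Let_def
      by (intro hard_threshold_minimizes) auto
    \<comment> \<open>Completing the square: the squares of the gradient entry cancel in the
      difference.\<close>
    moreover have "h / 2 * (y $ i - ?p)\<^sup>2 - h / 2 * (x $ i - ?p)\<^sup>2
        = ?g $ i * (y - x) $ i + h / 2 * ((y - x) $ i)\<^sup>2"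
      using assms(1) by (simp add: field_simps power2_eq_square)
    ultimately show ?thesis by simp
  qed
  have "?g \<bullet> (y - x) + h / 2 * (norm (y - x))\<^sup>2 + lam * real (l0_norm y)
      = (\<Sum>i\<in>UNIV. ?g $ i * (y - x) $ i + h / 2 * ((y - x) $ i)\<^sup>2 + lam * of_bool (y $ i \<noteq> 0))"
    unfolding power2_norm_eq_inner l0_norm_eq_sum
    by (simp add: inner_vec_def sum.distrib sum_distrib_left power2_eq_square)
  also have "\<dots> \<le> lam * real (l0_norm x)"
    unfolding l0_norm_eq_sum sum_distrib_left by (intro sum_mono comp)
  finally have 1: "?g \<bullet> (y - x) + h / 2 * (norm (y - x))\<^sup>2 + lam * real (l0_norm y)
      \<le> lam * real (l0_norm x)" .
  have "(norm (A *v (y - x)))\<^sup>2 \<le> (spectral_norm A * norm (y - x))\<^sup>2"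
    by (intro power_mono norm_matrix_vector_le) simp
  then have 2: "(norm (A *v (y - x)))\<^sup>2 \<le> (spectral_norm A)\<^sup>2 * (norm (y - x))\<^sup>2"
    by (simp only: power_mult_distrib)
  have "(h - (spectral_norm A)\<^sup>2) / 2 * (norm (y - x))\<^sup>2
      = h / 2 * (norm (y - x))\<^sup>2 - 1 / 2 * ((spectral_norm A)\<^sup>2 * (norm (y - x))\<^sup>2)"
    by (simp add: field_simps)
  with 1 2 show ?thesis
    unfolding Phi0_def quadratic_expansion[of b A y x] by linarith
qed

lemma line_search_step:
  fixes F :: "real ^ 'n \<Rightarrow> real" and y d :: "real ^ 'n" and M :: nat
  assumes "0 < alpha" and "0 < eta" and "eta < 1"
  defines "s \<equiv> line_search_step F alpha eta M y d"
  shows "0 \<le> s" and "s \<le> eta" and "F (y + s *\<^sub>R d) \<le> F y"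
proof -
  let ?ok = "{m::nat. 1 \<le> m \<and> F (y + eta ^ m *\<^sub>R d) \<le> F y - alpha * eta ^ m * (norm d)\<^sup>2}"
  have "0 \<le> s \<and> s \<le> eta \<and> F (y + s *\<^sub>R d) \<le> F y"
  proof (cases "line_search_index F alpha eta y d \<le> enat M")
    case False
    then show ?thesis
      using assms by (simp add: s_def line_search_step_def)
  next
    case True
    \<comment> \<open>An empty set would give index infinity, which exceeds \<open>M\<close>; a
      nonempty set of naturals attains its infimum.\<close>
    have "?ok \<noteq> {}"
    proof
      assume "?ok = {}"
      then have "line_search_index F alpha eta y d = \<infinity>"
        unfolding line_search_index_def by (simp only: image_empty Inf_empty top_enat_def)
      with True show False by simp
    qed
    then have "line_search_index F alpha eta y d \<in> enat ` ?ok"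
      unfolding line_search_index_def using wellorder_InfI[of _ "enat ` ?ok"] by blast
    then obtain m where m: "m \<in> ?ok" and "line_search_index F alpha eta y d = enat m"
      by blast
    with True have s: "s = eta ^ m"
      by (simp add: s_def line_search_step_def)
    \<comment> \<open>Exponents start at 1, so the step is at most \<open>eta\<close>; this keeps
      the total step factor \<open>s + 1\<close> below 2.\<close>
    have "eta ^ m \<le> eta ^ 1"
      using m assms by (intro power_decreasing) auto
    moreover have "0 \<le> alpha * eta ^ m * (norm d)\<^sup>2"
      using assms by simp
    ultimately show ?thesis
      using m assms(2) unfolding s by auto
  qed
  then show "0 \<le> s" and "s \<le> eta" and "F (y + s *\<^sub>R d) \<le> F y"
    by auto
qed

text \<open>This hides the line search: each update is a relaxed step with factor in [1, 2) that
  does not undo the descent achieved by \<open>iht_y\<close>.\<close>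

lemma iht_ls_updateE:
  fixes A :: "real ^ 'n ^ 'm"
  assumes "0 < alpha" and "0 < eta" and "eta < 1"
  obtains s where "0 \<le> s" and "s \<le> eta"
    and "iht_ls_update A b lam h alpha eta M x = x + (s + 1) *\<^sub>R (iht_y A b lam h x - x)"
    and "Phi0 A b lam (iht_ls_update A b lam h alpha eta M x) \<le> Phi0 A b lam (iht_y A b lam h x)"
proof -
  let ?y = "iht_y A b lam h x"
  define s where "s = line_search_step (Phi0 A b lam) alpha eta M ?y (?y - x)"
  note s = line_search_step[OF assms, where F = "Phi0 A b lam" and M = M and y = ?y and d = "?y - x",
      folded s_def]
  have u: "iht_ls_update A b lam h alpha eta M x = x + (s + 1) *\<^sub>R (?y - x)"
    unfolding iht_ls_update_def Let_def s_def ..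
  also have "\<dots> = ?y + s *\<^sub>R (?y - x)"
    by (simp add: algebra_simps)
  finally show thesis
    using s u that by auto
qed

text \<open>Objective values decrease and are nonnegative, so their successive differences vanish;
  each difference dominates \<open>c\<close> times the squared norm of the direction.\<close>

lemma iht_direction_tendsto_zero:
  fixes A :: "real ^ 'n ^ 'm"
  assumes "0 < lam" and "0 < alpha" and h: "(spectral_norm A)\<^sup>2 < h" and "0 < eta" and "eta < 1"
    and seq: "iht_ls_sequence A b lam h alpha eta M x"
  shows "(\<lambda>k. iht_y A b lam h (x k) - x k) \<longlonglongrightarrow> 0"
proof -
  define c where "c = (h - (spectral_norm A)\<^sup>2) / 2"
  have c: "0 < c"
    using h unfolding c_def by simp
  have "0 < h"
    using h zero_le_power2[of "spectral_norm A"] by linarith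
  let ?phi = "\<lambda>k. Phi0 A b lam (x k)"
  let ?d = "\<lambda>k. iht_y A b lam h (x k) - x k"
  have step: "?phi (Suc k) + c * (norm (?d k))\<^sup>2 \<le> ?phi k" for k
  proof -
    have "?phi (Suc k) \<le> Phi0 A b lam (iht_y A b lam h (x k))"
      using seq unfolding iht_ls_sequence_def
      by (metis iht_ls_updateE[OF assms(2,4,5)])
    with iht_y_descent[OF \<open>0 < h\<close> \<open>0 < lam\<close>, of A b "x k"] show ?thesis
      unfolding c_def by simp
  qed
  have "?phi (Suc k) \<le> ?phi k" for k
    using step[of k] c by (smt (verit) zero_le_mult_iff zero_le_power2)
  then have "decseq ?phi"
    by (rule decseq_SucI)
  moreover have "0 \<le> ?phi k" for k
    unfolding Phi0_def using \<open>0 < lam\<close> by simp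
  ultimately obtain l where l: "?phi \<longlonglongrightarrow> l"
    using decseq_convergent[of ?phi 0] by blast
  have "(\<lambda>k. (?phi k - ?phi (Suc k)) / c) \<longlonglongrightarrow> (l - l) / c"
    using c by (intro tendsto_intros l LIMSEQ_Suc[OF l]) auto
  then have lim: "(\<lambda>k. (?phi k - ?phi (Suc k)) / c) \<longlonglongrightarrow> 0"
    by simp
  have "(norm (?d k))\<^sup>2 \<le> (?phi k - ?phi (Suc k)) / c" for k
    using step[of k] c by (simp add: field_simps)
  then have "(\<lambda>k. (norm (?d k))\<^sup>2) \<longlonglongrightarrow> 0"
    by (intro tendsto_sandwich[OF _ _ tendsto_const lim]) auto
  then have "(\<lambda>k. sqrt ((norm (?d k))\<^sup>2)) \<longlonglongrightarrow> sqrt 0"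
    by (rule tendsto_real_sqrt)
  then show ?thesis
    by (simp add: tendsto_norm_zero_iff)
qed

section \<open>Convergence with a fixed support\<close>

text \<open>Compensating \<open>a\<close> for future perturbations makes it decreasing, hence
  convergent; the subsequence then identifies the limit as 0.\<close>

lemma quasi_Fejer_tendsto_zero:
  fixes a e :: "nat \<Rightarrow> real"
  assumes "\<And>k. 0 \<le> a k" and "\<And>k. 0 \<le> e k" and "eta < 1"
    and "\<And>k. a (Suc k) \<le> a k + e k" and "\<And>k. e (Suc k) \<le> eta * e k"
    and "strict_mono r" and "(\<lambda>k. a (r k)) \<longlonglongrightarrow> 0" and "(\<lambda>k. e (r k)) \<longlonglongrightarrow> 0"
  shows "a \<longlonglongrightarrow> 0"
proof -
  \<comment> \<open>\<open>e k / (1 - eta)\<close> bounds the sum of all later perturbations.\<close>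
  define w where "w k = a k + e k / (1 - eta)" for k
  have "w (Suc k) \<le> w k" for k
  proof -
    have "e (Suc k) / (1 - eta) \<le> eta * e k / (1 - eta)"
      using assms(3,5) by (intro divide_right_mono) auto
    also have "\<dots> = e k / (1 - eta) - e k"
      using assms(3) by (simp add: field_simps)
    finally show ?thesis
      using assms(4)[of k] unfolding w_def by simp
  qed
  then have "decseq w"
    by (rule decseq_SucI)
  moreover have "0 \<le> w k" for k
    unfolding w_def using assms(1-3) by simp
  ultimately obtain l where l: "w \<longlonglongrightarrow> l"
    using decseq_convergent[of w 0] by blast
  have "(\<lambda>k. w (r k)) \<longlonglongrightarrow> 0 + 0 / (1 - eta)"
    unfolding w_def using assms(3) by (intro tendsto_intros assms(7,8)) auto
  moreover have "(\<lambda>k. w (r k)) \<longlonglongrightarrow> l"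
    using LIMSEQ_subseq_LIMSEQ[OF l assms(6)] by (simp add: o_def)
  ultimately have "w \<longlonglongrightarrow> 0"
    using l LIMSEQ_unique by fastforce
  moreover have "a k \<le> w k" for k
    unfolding w_def using assms(2,3) by simp
  ultimately show ?thesis
    using assms(1) by (intro tendsto_sandwich[OF _ _ tendsto_const \<open>w \<longlonglongrightarrow> 0\<close>]) auto
qed

lemma iht_fixed_support_convergent:
  fixes A :: "real ^ 'n ^ 'm"
  assumes "0 < lam" and "0 < alpha" and h: "(spectral_norm A)\<^sup>2 < h" and eta: "0 < eta" "eta < 1"
    and seq: "iht_ls_sequence A b lam h alpha eta M x" and bdd: "bounded (range x)"
    and S: "\<And>k i. iht_y A b lam h (x k) $ i \<noteq> 0 \<longleftrightarrow> i \<in> S"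
  obtains xstar where "x \<longlonglongrightarrow> xstar" and "\<And>i. xstar $ i \<noteq> 0 \<longleftrightarrow> i \<in> S"
    and "\<And>i. i \<in> S \<Longrightarrow> (transpose A *v (A *v xstar - b)) $ i = 0"
proof -
  have "0 < h"
    using h zero_le_power2[of "spectral_norm A"] by linarith
  let ?y = "\<lambda>k. iht_y A b lam h (x k)"
  let ?g = "\<lambda>z. transpose A *v (A *v z - b)"
  have d0: "(\<lambda>k. ?y k - x k) \<longlonglongrightarrow> 0"
    by (rule iht_direction_tendsto_zero[OF assms(1-6)])
  have "\<exists>s. 0 \<le> s \<and> s \<le> eta \<and> x (Suc k) = x k + (s + 1) *\<^sub>R (?y k - x k)" for k
    using seq unfolding iht_ls_sequence_def by (metis iht_ls_updateE[OF assms(2) eta])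
  then obtain s where s: "\<And>k. 0 \<le> s k" "\<And>k. s k \<le> eta"
      "\<And>k. x (Suc k) = x k + (s k + 1) *\<^sub>R (?y k - x k)"
    by metis
  obtain xstar r where r: "strict_mono r" and xr: "(x \<circ> r) \<longlonglongrightarrow> xstar"
    using bounded_imp_convergent_subsequence[OF bdd] by blast
  \<comment> \<open>Since the directions vanish, \<open>?y\<close> shares the cluster point; its gap
    between zero and nonzero entries thus passes to \<open>xstar\<close>.\<close>
  have yr: "(\<lambda>k. ?y (r k)) \<longlonglongrightarrow> xstar"
    using tendsto_add[OF LIMSEQ_subseq_LIMSEQ[OF d0 r] xr] by (simp add: o_def)
  have yS: "?y k $ i = x k $ i - (1 / h) * ?g (x k) $ i" if "i \<in> S" for i k
    using S[of k i] that unfolding iht_y_component Let_def by (auto split: if_splits)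
  have y_large: "sqrt (2 * (lam / h)) \<le> \<bar>?y k $ i\<bar>" if "i \<in> S" for i k
    using S[of k i] that unfolding iht_y_component Let_def by (auto split: if_splits)
  have supp: "xstar $ i \<noteq> 0 \<longleftrightarrow> i \<in> S" for i
  proof (cases "i \<in> S")
    case True
    have "(\<lambda>k. \<bar>?y (r k) $ i\<bar>) \<longlonglongrightarrow> \<bar>xstar $ i\<bar>"
      by (intro tendsto_intros yr)
    then have "sqrt (2 * (lam / h)) \<le> \<bar>xstar $ i\<bar>"
      by (rule LIMSEQ_le_const) (use True y_large in auto)
    moreover have "0 < sqrt (2 * (lam / h))"
      using \<open>0 < h\<close> \<open>0 < lam\<close> by simp
    ultimately show ?thesis
      using True by auto
  next
    case False
    have "(\<lambda>k. ?y (r k) $ i) \<longlonglongrightarrow> xstar $ i"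
      by (intro tendsto_intros yr)
    moreover have "?y (r k) $ i = 0" for k
      using S False by blast
    ultimately have "(\<lambda>k. 0) \<longlonglongrightarrow> xstar $ i"
      by simp
    then show ?thesis
      using False by (simp add: LIMSEQ_const_iff)
  qed
  have grad: "?g xstar $ i = 0" if i: "i \<in> S" for i
  proof -
    \<comment> \<open>On \<open>S\<close> no entry is cut off, so the gradient entry is
      \<open>- h\<close> times the direction and must vanish in the limit.\<close>
    have "(\<lambda>k. (- h) * (?y k - x k) $ i) \<longlonglongrightarrow> (- h) * 0 $ i"
      by (intro tendsto_intros d0)
    moreover have "(- h) * (?y k - x k) $ i = ?g (x k) $ i" for k
      using yS[OF i, of k] \<open>0 < h\<close> by (simp add: field_simps)
    ultimately have "(\<lambda>k. ?g (x k) $ i) \<longlonglongrightarrow> 0"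
      by simp
    from LIMSEQ_subseq_LIMSEQ[OF this r] have "(\<lambda>k. ?g (x (r k)) $ i) \<longlonglongrightarrow> 0"
      by (simp add: o_def)
    moreover have "(\<lambda>k. ?g (x (r k)) $ i) \<longlonglongrightarrow> ?g xstar $ i"
      using xr by (intro tendsto_intros bounded_linear.tendsto[OF matrix_vector_mul_bounded_linear])
        (simp add: o_def)
    ultimately show ?thesis
      using LIMSEQ_unique by blast
  qed
  \<comment> \<open>The orthogonal projection onto the coordinates in \<open>T\<close>.\<close>
  define P where "P T z = (\<chi> i. if i \<in> T then z $ i else 0)" for T :: "'n set" and z :: "real ^ 'n"
  have P_le: "norm (P T z) \<le> norm z" for T z
    by (rule norm_le_componentwise_cart) (simp add: P_def)
  have P_split: "z = P S z + P (- S) z" for z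
    by (simp add: P_def vec_eq_iff)
  have P_tendsto: "(\<lambda>k. norm (P T (x (r k) - xstar))) \<longlonglongrightarrow> 0" for T
  proof -
    have "(\<lambda>k. x (r k) - xstar) \<longlonglongrightarrow> 0"
      using xr by (simp add: o_def LIM_zero)
    then have "(\<lambda>k. norm (x (r k) - xstar)) \<longlonglongrightarrow> 0"
      by (rule tendsto_norm_zero)
    then show ?thesis
      using P_le by (intro tendsto_sandwich[OF _ _ tendsto_const \<open>(\<lambda>k. norm (x (r k) - xstar)) \<longlonglongrightarrow> 0\<close>]) auto
  qed
  \<comment> \<open>As the gradient at \<open>xstar\<close> vanishes on \<open>S\<close>, the error
    there undergoes a linear gradient step. That step sees the whole error, so the part off
    \<open>S\<close> enters as the perturbation.\<close>
  have on_S: "norm (P S (x (Suc k) - xstar)) \<le> norm (P S (x k - xstar)) + norm (P (- S) (x k - xstar))" for k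
  proof -
    let ?v = "x k - xstar" and ?t = "(s k + 1) / h"
    have "?g (x k) = ?g xstar + transpose A *v (A *v ?v)"
      by (simp add: matrix_vector_mult_diff_distrib)
    then have "P S (x (Suc k) - xstar) = P S (?v - ?t *\<^sub>R (transpose A *v (A *v ?v)))"
      using s(3)[of k] yS[of _ k] grad \<open>0 < h\<close> by (simp add: P_def vec_eq_iff)
    also have "norm \<dots> \<le> norm (?v - ?t *\<^sub>R (transpose A *v (A *v ?v)))"
      by (rule P_le)
    also have "\<dots> \<le> norm ?v"
    proof (rule gradient_step_nonexpansive)
      show "0 \<le> ?t"
        using s(1)[of k] \<open>0 < h\<close> by simp
      then have "?t * (spectral_norm A)\<^sup>2 \<le> ?t * h"
        using h by (intro mult_left_mono) auto
      also have "\<dots> \<le> 2"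
        using s(2)[of k] eta \<open>0 < h\<close> by simp
      finally show "?t * (spectral_norm A)\<^sup>2 \<le> 2" .
    qed
    also have "\<dots> \<le> norm (P S ?v) + norm (P (- S) ?v)"
      by (subst P_split) (rule norm_triangle_ineq)
    finally show ?thesis .
  qed
  have off_S: "norm (P (- S) (x (Suc k) - xstar)) \<le> eta * norm (P (- S) (x k - xstar))" for k
  proof -
    have y0: "?y k $ i = 0" and xstar0: "xstar $ i = 0" if "i \<notin> S" for i
      using S supp that by blast+
    \<comment> \<open>Here the direction is \<open>- x k\<close>: a unit step reaches 0, and the
      extra \<open>s k\<close> overshoots with reversed sign.\<close>
    have "x (Suc k) $ i = - s k * x k $ i" if "i \<notin> S" for i
      unfolding s(3) by (simp add: y0[OF that] algebra_simps)
    then have "P (- S) (x (Suc k) - xstar) = (- s k) *\<^sub>R P (- S) (x k - xstar)"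
      by (simp add: P_def vec_eq_iff xstar0)
    then show ?thesis
      using s(1,2)[of k] by (simp add: mult_right_mono)
  qed
  have lim_S: "(\<lambda>k. norm (P S (x k - xstar))) \<longlonglongrightarrow> 0"
    by (rule quasi_Fejer_tendsto_zero[where e = "\<lambda>k. norm (P (- S) (x k - xstar))", OF _ _ eta(2) on_S off_S r])
      (simp_all add: P_tendsto)
  have "(\<lambda>k. norm (P (- S) (x k - xstar))) \<longlonglongrightarrow> 0"
  \<comment> \<open>Off \<open>S\<close> the norms themselves decrease, so the perturbation is taken
    to be zero.\<close>
  proof (rule quasi_Fejer_tendsto_zero[where e = "\<lambda>_. 0", OF _ _ eta(2) _ _ r])
    show "norm (P (- S) (x (Suc k) - xstar)) \<le> norm (P (- S) (x k - xstar)) + 0" for k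
      using off_S[of k] eta mult_right_mono[of eta 1 "norm (P (- S) (x k - xstar))"] by simp
  qed (simp_all add: P_tendsto)
  then have "(\<lambda>k. norm (P S (x k - xstar)) + norm (P (- S) (x k - xstar))) \<longlonglongrightarrow> 0"
    by (intro tendsto_add_zero lim_S)
  moreover have "norm (x k - xstar) \<le> norm (P S (x k - xstar)) + norm (P (- S) (x k - xstar))" for k
    by (subst P_split) (rule norm_triangle_ineq)
  ultimately have "(\<lambda>k. x k - xstar) \<longlonglongrightarrow> 0"
    by (rule Lim_null_comparison[OF always_eventually, OF allI, rotated])
  then have "x \<longlonglongrightarrow> xstar"
    by (rule LIM_zero_cancel)
  then show thesis
    using supp grad that by blast
qed

text \<open>A change of support moves some entry by at least \<open>tau\<close>, whereas consecutive
  \<open>?y\<close> eventually differ by less.\<close>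

lemma iht_y_eventually_fixed_support:
  fixes A :: "real ^ 'n ^ 'm"
  assumes "0 < lam" and "0 < alpha" and h: "(spectral_norm A)\<^sup>2 < h" and eta: "0 < eta" "eta < 1"
    and seq: "iht_ls_sequence A b lam h alpha eta M x"
  obtains K S where "\<And>k i. k \<ge> K \<Longrightarrow> iht_y A b lam h (x k) $ i \<noteq> 0 \<longleftrightarrow> i \<in> S"
proof -
  have "0 < h"
    using h zero_le_power2[of "spectral_norm A"] by linarith
  let ?y = "\<lambda>k. iht_y A b lam h (x k)"
  define tau where "tau = sqrt (2 * (lam / h))"
  have "0 < tau"
    unfolding tau_def using \<open>0 < h\<close> \<open>0 < lam\<close> by simp
  have y_large: "?y k $ i = 0 \<or> tau \<le> \<bar>?y k $ i\<bar>" for i k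
    unfolding iht_y_component Let_def tau_def by simp
  have d0: "(\<lambda>k. ?y k - x k) \<longlonglongrightarrow> 0"
    by (rule iht_direction_tendsto_zero[OF assms])
  have "norm (?y (Suc k) - ?y k) \<le> norm (?y (Suc k) - x (Suc k)) + norm (?y k - x k)" for k
  proof -
    obtain s where s: "0 \<le> s" "s \<le> eta" "x (Suc k) = x k + (s + 1) *\<^sub>R (?y k - x k)"
      using seq unfolding iht_ls_sequence_def by (metis iht_ls_updateE[OF assms(2) eta])
    \<comment> \<open>The new iterate is \<open>?y k\<close> plus \<open>s\<close> times the old
      direction, so only two vanishing directions contribute.\<close>
    have "?y (Suc k) - ?y k = (?y (Suc k) - x (Suc k)) + s *\<^sub>R (?y k - x k)"
      unfolding s(3) by (simp add: algebra_simps)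
    then have "norm (?y (Suc k) - ?y k) \<le> norm (?y (Suc k) - x (Suc k)) + norm (s *\<^sub>R (?y k - x k))"
      using norm_triangle_ineq by metis
    moreover have "norm (s *\<^sub>R (?y k - x k)) \<le> norm (?y k - x k)"
      using s(1,2) eta by (simp add: mult_left_le_one_le)
    ultimately show ?thesis by linarith
  qed
  moreover have "(\<lambda>k. norm (?y (Suc k) - x (Suc k)) + norm (?y k - x k)) \<longlonglongrightarrow> 0"
    by (intro tendsto_add_zero tendsto_norm_zero d0 LIMSEQ_Suc[OF d0])
  ultimately have "(\<lambda>k. ?y (Suc k) - ?y k) \<longlonglongrightarrow> 0"
    by (rule Lim_null_comparison[OF always_eventually, OF allI])
  then obtain K where K: "\<And>k. k \<ge> K \<Longrightarrow> norm (?y (Suc k) - ?y k) < tau"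
    using LIMSEQ_D[OF _ \<open>0 < tau\<close>] by fastforce
  have step: "?y (Suc k) $ i \<noteq> 0 \<longleftrightarrow> ?y k $ i \<noteq> 0" if "k \<ge> K" for k i
  proof -
    have "\<bar>?y (Suc k) $ i - ?y k $ i\<bar> < tau"
      using component_le_norm_cart[of "?y (Suc k) - ?y k" i] K[OF that] by simp
    then show ?thesis
      using y_large[of k i] y_large[of "Suc k" i] by auto
  qed
  show thesis
  proof (rule that)
    fix k i assume "k \<ge> K"
    then show "?y k $ i \<noteq> 0 \<longleftrightarrow> i \<in> {i. ?y K $ i \<noteq> 0}"
      by (induction rule: dec_induct) (use step in auto)
  qed
qed

section \<open>Criticality of the limit\<close>

text \<open>The comparison is made per coordinate. Near \<open>u\<close>, nonzero entries stay
  nonzero and have no linear term; a zero entry that becomes nonzero costs \<open>lam\<close>, more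
  than its small linear term can gain. The quadratic remainder is nonnegative.\<close>

lemma Phi0_local_minimizer:
  fixes A :: "real ^ 'n ^ 'm"
  assumes "0 < lam"
    and grad: "\<And>i. u $ i \<noteq> 0 \<Longrightarrow> (transpose A *v (A *v u - b)) $ i = 0"
  shows "\<forall>\<^sub>F z in at u. Phi0 A b lam u \<le> Phi0 A b lam z"
proof -
  let ?g = "transpose A *v (A *v u - b)"
  have lim: "((\<lambda>z. z $ i) \<longlongrightarrow> u $ i) (at u)" for i
    by (intro tendsto_intros)
  have ev: "\<forall>\<^sub>F z in at u. lam * of_bool (u $ i \<noteq> 0)
      \<le> ?g $ i * (z - u) $ i + lam * of_bool (z $ i \<noteq> 0)" for i
  proof (cases "u $ i = 0")
    case True
    have "((\<lambda>z. ?g $ i * z $ i) \<longlongrightarrow> ?g $ i * u $ i) (at u)"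
      by (intro tendsto_intros)
    then have "\<forall>\<^sub>F z in at u. - lam < ?g $ i * z $ i"
      using True \<open>0 < lam\<close> by (intro order_tendstoD(1)) auto
    then show ?thesis
      by eventually_elim (use True in auto)
  next
    case False
    then have "\<forall>\<^sub>F z in at u. z $ i \<noteq> 0"
      using lim[of i] by (rule tendsto_imp_eventually_ne[rotated])
    then show ?thesis
      by eventually_elim (use False grad in auto)
  qed
  then have "\<forall>\<^sub>F z in at u. \<forall>i. lam * of_bool (u $ i \<noteq> 0)
      \<le> ?g $ i * (z - u) $ i + lam * of_bool (z $ i \<noteq> 0)"
    by (simp add: eventually_all_finite)
  then show ?thesis
  proof eventually_elim
    case (elim z)
    then have "lam * real (l0_norm u) \<le> ?g \<bullet> (z - u) + lam * real (l0_norm z)"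
      unfolding l0_norm_eq_sum inner_vec_def sum_distrib_left sum.distrib[symmetric]
      by (intro sum_mono) simp
    moreover have "0 \<le> 1 / 2 * (norm (A *v (z - u)))\<^sup>2"
      by simp
    ultimately show ?case
      unfolding Phi0_def quadratic_expansion[of b A z u] by linarith
  qed
qed

theorem corollary4p2:
  fixes A :: "real ^ 'n ^ 'm" and b :: "real ^ 'm"
    and lam h alpha eta :: real and M :: nat
    and x :: "nat \<Rightarrow> real ^ 'n"
  assumes "lam > 0" and "alpha > 0" and "h > (spectral_norm A)\<^sup>2"
    and "0 < eta" and "eta < 1"
    and "iht_ls_sequence A b lam h alpha eta M x"
    and "bounded (range x)"
  shows "\<exists>xstar. x \<longlonglongrightarrow> xstar \<and>
           0 \<in> limiting_subdifferential (\<lambda>z. ereal (Phi0 A b lam z)) xstar"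
proof -
  obtain K S where KS: "\<And>k i. k \<ge> K \<Longrightarrow> iht_y A b lam h (x k) $ i \<noteq> 0 \<longleftrightarrow> i \<in> S"
    using iht_y_eventually_fixed_support[OF assms(1-6)] by blast
  \<comment> \<open>The update depends only on the current iterate, so the tail from
    \<open>K\<close> on is again generated by the algorithm, now with constant support
    \<open>S\<close>.\<close>
  let ?x = "\<lambda>k. x (k + K)"
  have seq: "iht_ls_sequence A b lam h alpha eta M ?x"
    using assms(6) unfolding iht_ls_sequence_def by simp
  have bdd: "bounded (range ?x)"
    by (rule bounded_subset[OF assms(7)]) auto
  have S: "iht_y A b lam h (?x k) $ i \<noteq> 0 \<longleftrightarrow> i \<in> S" for k i
    by (rule KS) simp
  obtain xstar where lim: "?x \<longlonglongrightarrow> xstar" and supp: "\<And>i. xstar $ i \<noteq> 0 \<longleftrightarrow> i \<in> S"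
    and grad: "\<And>i. i \<in> S \<Longrightarrow> (transpose A *v (A *v xstar - b)) $ i = 0"
    using iht_fixed_support_convergent[OF assms(1-5) seq bdd S] by blast
  have "\<forall>\<^sub>F z in at xstar. Phi0 A b lam xstar \<le> Phi0 A b lam z"
    using assms(1) grad supp by (intro Phi0_local_minimizer) auto
  then have "0 \<in> limiting_subdifferential (\<lambda>z. ereal (Phi0 A b lam z)) xstar"
    using zero_in_frechet_subdifferential frechet_subset_limiting_subdifferential by blast
  moreover have "x \<longlonglongrightarrow> xstar"
    using lim by (rule LIMSEQ_offset)
  ultimately show ?thesis
    by blast
qed

end
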